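(* For every integer $r\ge 3$, $rx_3(K_{r,r})=3$, where $K_{r,r}$ is the complete bipartite graph with both partite sets of size $r$.
   Context: All graphs are finite, simple and undirected. Edge-colorings are arbitrary maps from $E(G)$ to a finite set of colors (adjacent edges may receive the same color). A tree $T$ that is a subgraph of an edge-colored graph $G$ is a rainbow tree if no two edges of $T$ have the same color. For $S\subseteq V(G)$, a rainbow $S$-tree is a rainbow tree in $G$ whose vertex set contains $S$ (it may contain other vertices). For a connected graph $G$ of order at least $3$, $rx_3(G)$ (the $3$-rainbow index) is the minimum number of colors in an edge-coloring of $G$ such that for every $3$-element subset $S$ of $V(G)$ there is a rainbow $S$-tree. *)

theory Defs
  imports "Graph_Theory.Kuratowski"
begin

(* Finite simple undirected graphs are the symmetric digraphs satisfying pair_graph.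
   Each undirected edge is then a pair of opposite arcs, so colorings and the rainbow
   condition are stated on the unordered edges below. *)

definition uedges :: "'a pair_pre_digraph \<Rightarrow> 'a set set" where
  "uedges G = {{u, v} | u v. (u, v) \<in> parcs G}"

(* Digraph_Component.tree is unsuitable here: in a symmetric digraph every edge yields a
   closed walk u, v, u, which counts as a cycle. Undirected cycles are those of length at
   least 3. *)

definition undirected_tree :: "'a pair_pre_digraph \<Rightarrow> bool" where
  "undirected_tree T \<longleftrightarrow> pair_graph T \<and> Digraph_Component.connected (with_proj T) \<and>
     \<not> (\<exists>p. pre_digraph.cycle (with_proj T) p \<and> 3 \<le> length p)"

definition rainbow_tree ::
  "'a pair_pre_digraph \<Rightarrow> ('a set \<Rightarrow> nat) \<Rightarrow> 'a pair_pre_digraph \<Rightarrow> bool" where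
  "rainbow_tree G c T \<longleftrightarrow>
     subgraph (with_proj T) (with_proj G) \<and> undirected_tree T \<and> inj_on c (uedges T)"

definition rainbow_S_tree ::
  "'a pair_pre_digraph \<Rightarrow> ('a set \<Rightarrow> nat) \<Rightarrow> 'a set \<Rightarrow> 'a pair_pre_digraph \<Rightarrow> bool" where
  "rainbow_S_tree G c S T \<longleftrightarrow> rainbow_tree G c T \<and> S \<subseteq> pverts T"

definition rainbow_coloring_3 :: "'a pair_pre_digraph \<Rightarrow> ('a set \<Rightarrow> nat) \<Rightarrow> bool" where
  "rainbow_coloring_3 G c \<longleftrightarrow>
     (\<forall>S. S \<subseteq> pverts G \<and> card S = 3 \<longrightarrow> (\<exists>T. rainbow_S_tree G c S T))"

(* Only the values of c on uedges G matter. The value of rx3 is meaningful for connected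
   graphs of order at least 3; there an injective coloring shows that LEAST ranges over a
   nonempty set. *)

definition rx3 :: "'a pair_pre_digraph \<Rightarrow> nat" where
  "rx3 G = (LEAST k. \<exists>c. card (c ` uedges G) = k \<and> rainbow_coloring_3 G c)"

end

theory Submission
  imports Defs
begin

text \<open>
  At least three colours are needed because of triples inside one side of the bipartition: a tree
  containing three such vertices has an edge at each of them, and these three edges are distinct
  since edges only run between the two sides.

  Three colours suffice. Number both sides by the same \<open>r\<close> indices and colour the edge \<open>u v\<close>
  by comparing the index of \<open>u\<close> with that of \<open>v\<close>: one colour for equality, one for
  smaller, one for larger. Three vertices on one side with indices \<open>i < j < k\<close> are the
  leaves of a star centred at the opposite vertex of index \<open>j\<close>, which sees them in three
  different colours. Two vertices of indices \<open>i < j\<close> together with an opposite vertex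
  \<open>w\<close> of index \<open>k\<close> form a rainbow path through \<open>w\<close> unless \<open>k\<close> lies on the same
  side of both \<open>i\<close> and \<open>j\<close>. In that case \<open>w\<close> is joined to the nearer of the two in the
  colour of its comparison; from there a zigzag through the opposite vertex whose index is that
  of the farther one uses the other strict comparison and then equality. The colouring is
  symmetric in the two sides, up to exchanging the two strict colours, so these cases are all
  there are.
\<close>

section \<open>Growing rainbow trees leaf by leaf\<close>

definition add_leaf :: "'a pair_pre_digraph \<Rightarrow> 'a \<Rightarrow> 'a \<Rightarrow> 'a pair_pre_digraph" where
  "add_leaf T x y =
     \<lparr>pverts = insert y (pverts T), parcs = insert (x, y) (insert (y, x) (parcs T))\<rparr>"

lemma uedges_add_leaf: "uedges (add_leaf T x y) = insert {x, y} (uedges T)"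
  unfolding uedges_def add_leaf_def by (auto simp: insert_commute)

lemma pcas_append_iff: "pcas u (p @ q) w \<longleftrightarrow> (\<exists>v. pcas u p v \<and> pcas v q w)"
  by (induction p arbitrary: u) auto

lemma tl_pawalk_verts: "pcas u p v \<Longrightarrow> tl (pawalk_verts u p) = map snd p"
proof (induction p arbitrary: u)
  case (Cons e p)
  then show ?case by (cases p) auto
qed simp

lemma pcas_snd_last: "pcas u p v \<Longrightarrow> p \<noteq> [] \<Longrightarrow> snd (last p) = v"
  by (induction p arbitrary: u) auto

lemma rotate_closed_walk:
  assumes "pcas u p u" "(x, y) \<in> set p" "distinct (map snd p)"
  obtains q where "pcas y q x" "set p = insert (x, y) (set q)" "length p = Suc (length q)"
    "distinct (map snd q)" "y \<notin> snd ` set q"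
proof -
  obtain p1 p2 where p: "p = p1 @ (x, y) # p2" using assms(2) by (meson split_list)
  show thesis
    by (rule that[of "p2 @ p1"]) (use assms(1,3) in \<open>auto simp: p pcas_append_iff\<close>)
qed

text \<open>
  A closed walk reaching the leaf \<open>y\<close> has to enter it from its neighbour \<open>x\<close> and to return to
  \<open>x\<close> at once. If the walk has length at least 3 it then visits \<open>x\<close> twice, which a
  cycle does not do.
\<close>

lemma cycle_avoids_leaf:
  assumes walk: "pcas u p u" and dist: "distinct (map snd p)" and len: "3 \<le> length p"
    and arcs: "set p \<subseteq> insert (x, y) (insert (y, x) A)"
    and leaf: "\<And>e. e \<in> A \<Longrightarrow> fst e \<noteq> y \<and> snd e \<noteq> y" and "x \<noteq> y"
  shows "set p \<subseteq> A"
proof -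
  have "(y, x) \<notin> set p"
  proof
    assume "(y, x) \<in> set p"
    then obtain q where q: "pcas x q y" "set p = insert (y, x) (set q)"
      "length p = Suc (length q)" "x \<notin> snd ` set q"
      using rotate_closed_walk[OF walk _ dist] by metis
    then obtain e q' where e: "q = q' @ [e]" using len by (cases q rule: rev_cases) auto
    with q have "snd e = y" by (auto simp: pcas_append_iff)
    moreover have "e \<in> set p" using q e by auto
    ultimately have "e = (x, y)" using arcs leaf[of e] \<open>x \<noteq> y\<close>
      by (metis insertE snd_conv subsetD)
    then have "pcas x q' x" using q e by (auto simp: pcas_append_iff)
    moreover have "q' \<noteq> []" using len q e by auto
    ultimately have "x \<in> snd ` set q'" using pcas_snd_last last_in_set by (metis image_eqI)
    then show False using q e by auto
  qed
  moreover have "(x, y) \<notin> set p"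
  proof
    assume "(x, y) \<in> set p"
    then obtain q where q: "pcas y q x" "set p = insert (x, y) (set q)"
      "length p = Suc (length q)"
      using rotate_closed_walk[OF walk _ dist] by metis
    then obtain e q' where e: "q = e # q'" using len by (cases q) auto
    then have "fst e = y" "e \<in> set p" using q by auto
    then have "e = (y, x)" using arcs leaf[of e] \<open>x \<noteq> y\<close>
      by (metis fst_conv insertE subsetD)
    then show False using \<open>e \<in> set p\<close> \<open>(y, x) \<notin> set p\<close> by simp
  qed
  ultimately show ?thesis using arcs by blast
qed

lemma no_long_cycle_iff:
  "(\<exists>p. pre_digraph.cycle (with_proj T) p \<and> 3 \<le> length p) \<longleftrightarrow>
   (\<exists>u p. u \<in> pverts T \<and> set p \<subseteq> parcs T \<and> pcas u p u \<and> distinct (map snd p) \<and> 3 \<le> length p)"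
proof -
  have "pre_digraph.cycle (with_proj T) p \<longleftrightarrow>
      (\<exists>u. u \<in> pverts T \<and> set p \<subseteq> parcs T \<and> pcas u p u \<and> distinct (map snd p) \<and> p \<noteq> [])" for p
    unfolding pre_digraph.cycle_def pre_digraph.awalk_def cas_with_proj_eq
      awalk_verts_with_proj_eq using tl_pawalk_verts by (metis with_proj_simps(1,2))
  then show ?thesis by (metis list.size(3) not_numeral_le_zero)
qed

lemma connected_add_leaf:
  assumes conn: "Digraph_Component.connected (with_proj T)" and x: "x \<in> pverts T"
  shows "Digraph_Component.connected (with_proj (add_leaf T x y))"
proof -
  define V R where "V = insert y (pverts T)" and "R = (insert (x, y) (insert (y, x) (parcs T)))\<^sup>s"
  have reach: "(u, v) \<in> rtrancl_on V R" if "u \<in> pverts T" "v \<in> pverts T" for u v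
  proof -
    have "(u, v) \<in> rtrancl_on (pverts T) ((parcs T)\<^sup>s)"
      using conn that by (simp add: connected_conv)
    then show ?thesis
      by (rule rtrancl_on_mono[rotated 2]) (auto simp: V_def R_def symcl_def)
  qed
  have xV: "x \<in> V" "y \<in> V" using x by (auto simp: V_def)
  have "(x, y) \<in> R" "(y, x) \<in> R" by (auto simp: R_def symcl_def)
  then have "(x, y) \<in> rtrancl_on V R" "(y, x) \<in> rtrancl_on V R"
    using xV by (meson rtrancl_on_into_rtrancl_on rtrancl_on_refl)+
  then have "(u, x) \<in> rtrancl_on V R \<and> (x, u) \<in> rtrancl_on V R" if "u \<in> V" for u
    using that reach x by (auto simp: V_def)
  then have "(u, v) \<in> rtrancl_on V R" if "u \<in> V" "v \<in> V" for u v
    using that by (meson rtrancl_on_trans)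
  then show ?thesis
    by (simp add: connected_conv add_leaf_def V_def[symmetric] R_def[symmetric])
       (simp add: V_def)
qed

lemma undirected_tree_add_leaf:
  assumes T: "undirected_tree T" and x: "x \<in> pverts T" and y: "y \<notin> pverts T"
  shows "undirected_tree (add_leaf T x y)"
proof -
  interpret T: pair_graph T using T by (simp add: undirected_tree_def)
  have leaf: "fst e \<noteq> y \<and> snd e \<noteq> y" if "e \<in> parcs T" for e
    using that y T.arc_fst_in_verts T.arc_snd_in_verts by blast
  have "x \<noteq> y" using x y by auto
  have "pair_graph (add_leaf T x y)"
    using T.in_arcsD1 T.in_arcsD2 T.pair_finite_verts T.pair_finite_arcs
      T.pair_no_loops T.sym_arcs x \<open>x \<noteq> y\<close>
    by unfold_locales (auto simp: add_leaf_def symmetric_def sym_def)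
  moreover have "\<not> (\<exists>p. pre_digraph.cycle (with_proj (add_leaf T x y)) p \<and> 3 \<le> length p)"
    unfolding no_long_cycle_iff
  proof (intro notI, elim exE conjE)
    fix u p
    assume p: "set p \<subseteq> parcs (add_leaf T x y)" "pcas u p u" "distinct (map snd p)" "3 \<le> length p"
    have sub: "set p \<subseteq> parcs T"
      using cycle_avoids_leaf[OF p(2-4) _ leaf \<open>x \<noteq> y\<close>] p(1) by (simp add: add_leaf_def)
    moreover have "u \<in> pverts T"
      using p(2,4) sub by (cases p) (auto dest: T.in_arcsD1)
    ultimately show False
      using T p unfolding undirected_tree_def no_long_cycle_iff by blast
  qed
  ultimately show ?thesis
    using T connected_add_leaf[OF _ x] by (simp add: undirected_tree_def)
qed

text \<open>
  Existence of a rainbow tree with given vertices and edges, which hides the arcs behind the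
  two ways of building one: a single vertex, and a new leaf on an edge of an unused colour.
\<close>

definition rainbow_tree_on ::
  "'a pair_pre_digraph \<Rightarrow> ('a set \<Rightarrow> nat) \<Rightarrow> 'a set \<Rightarrow> 'a set set \<Rightarrow> bool" where
  "rainbow_tree_on G c W F \<longleftrightarrow> (\<exists>T. rainbow_tree G c T \<and> pverts T = W \<and> uedges T = F)"

lemma rainbow_tree_on_single:
  assumes "pair_graph G" "v \<in> pverts G"
  shows "rainbow_tree_on G c {v} {}"
proof -
  interpret pair_graph G by fact
  define T :: "'a pair_pre_digraph" where "T = \<lparr>pverts = {v}, parcs = {}\<rparr>"
  interpret T: pair_graph T by unfold_locales (auto simp: T_def symmetric_def)
  have "undirected_tree T"
    using T.pair_graph_axioms
    by (auto simp: undirected_tree_def no_long_cycle_iff connected_conv) (auto simp: T_def)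
  moreover have "subgraph (with_proj T) (with_proj G)"
    using assms(2) wf_digraph T.wf_digraph
    by (auto simp: subgraph_def compatible_def) (auto simp: T_def)
  moreover have "uedges T = {}" by (simp add: uedges_def T_def)
  moreover have "pverts T = {v}" by (simp add: T_def)
  ultimately show ?thesis
    unfolding rainbow_tree_on_def rainbow_tree_def by (metis inj_on_empty)
qed

lemma rainbow_tree_on_insert_leaf:
  assumes W: "rainbow_tree_on G c W F" and x: "x \<in> W" and y: "y \<notin> W"
    and xy: "(x, y) \<in> parcs G" "(y, x) \<in> parcs G" and new: "c {x, y} \<notin> c ` F"
  shows "rainbow_tree_on G c (insert y W) (insert {x, y} F)"
proof -
  obtain T where T: "rainbow_tree G c T" and WF: "pverts T = W" "uedges T = F"
    using W by (auto simp: rainbow_tree_on_def)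
  have sub: "subgraph (with_proj T) (with_proj G)" and tree: "undirected_tree T"
    using T by (auto simp: rainbow_tree_def)
  have tree': "undirected_tree (add_leaf T x y)"
    by (rule undirected_tree_add_leaf[OF tree]) (use x y WF in auto)
  then interpret T': pair_graph "add_leaf T x y" by (simp add: undirected_tree_def)
  interpret G: pair_wf_digraph G
    using sub by (auto simp: subgraph_def wf_digraph_wp_iff)
  have "subgraph (with_proj (add_leaf T x y)) (with_proj G)"
    using sub xy T'.wf_digraph G.in_arcsD2[OF xy(1)]
    by (auto simp: subgraph_def compatible_def) (auto simp: add_leaf_def)
  moreover have "inj_on c (insert {x, y} F)"
    using T WF new by (auto simp: rainbow_tree_def)
  ultimately have "rainbow_tree G c (add_leaf T x y)"
    using tree' WF by (simp add: rainbow_tree_def uedges_add_leaf)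
  moreover have "pverts (add_leaf T x y) = insert y W" by (simp add: add_leaf_def WF)
  ultimately show ?thesis
    unfolding rainbow_tree_on_def using uedges_add_leaf WF by metis
qed

section \<open>Three colours are necessary\<close>

lemma connected_incident_edge:
  assumes conn: "Digraph_Component.connected (with_proj T)"
    and uw: "u \<in> pverts T" "w \<in> pverts T" "u \<noteq> w"
  obtains v where "{u, v} \<in> uedges T"
proof -
  have "(u, w) \<in> rtrancl_on (pverts T) ((parcs T)\<^sup>s)"
    using conn uw by (simp add: connected_conv)
  then obtain v where "(u, v) \<in> (parcs T)\<^sup>s"
    using \<open>u \<noteq> w\<close> by (cases rule: converse_rtrancl_on_cases) auto
  then have "{u, v} \<in> uedges T"
    unfolding uedges_def symcl_def by (auto simp: insert_commute)
  then show thesis by (rule that)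
qed

text \<open>
  Each vertex of an independent set lying in the tree has its own incident edge, so the
  tree has at least as many edges, hence colours, as the set has vertices.
\<close>

lemma card_independent_le_card_colors:
  assumes G: "pair_graph G" and T: "rainbow_S_tree G c S T"
    and indep: "\<And>u v. u \<in> S \<Longrightarrow> v \<in> S \<Longrightarrow> (u, v) \<notin> parcs G" and S: "2 \<le> card S"
  shows "card S \<le> card (c ` uedges G)"
proof -
  interpret G: pair_graph G by fact
  have sub: "parcs T \<subseteq> parcs G" and inj: "inj_on c (uedges T)" and ST: "S \<subseteq> pverts T"
    and conn: "Digraph_Component.connected (with_proj T)"
    using T by (auto simp: rainbow_S_tree_def rainbow_tree_def undirected_tree_def subgraph_def)
  have fin: "finite (uedges G)"
  proof -
    have "uedges G = (\<lambda>(u, v). {u, v}) ` parcs G" by (auto simp: uedges_def)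
    then show ?thesis using G.pair_finite_arcs by simp
  qed
  have subE: "uedges T \<subseteq> uedges G" using sub by (auto simp: uedges_def)
  have "\<exists>v. {u, v} \<in> uedges T" if u: "u \<in> S" for u
  proof -
    obtain w where "w \<in> S" "w \<noteq> u"
      using S card_mono[of "{u}" S] by fastforce
    then show ?thesis using connected_incident_edge[OF conn] u ST by (metis subsetD)
  qed
  then obtain nb where nb: "\<And>u. u \<in> S \<Longrightarrow> {u, nb u} \<in> uedges T" by metis
  have out: "nb u \<notin> S" if "u \<in> S" for u
  proof -
    have "{u, nb u} \<in> uedges G" using nb[OF that] subE by blast
    then have "(u, nb u) \<in> parcs G \<or> (nb u, u) \<in> parcs G"
      by (auto simp: uedges_def doubleton_eq_iff)
    then show ?thesis using indep that by blast
  qed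
  have "inj_on (\<lambda>u. {u, nb u}) S"
  proof (rule inj_onI)
    fix u w assume "u \<in> S" "w \<in> S" "{u, nb u} = {w, nb w}"
    then show "u = w" using out by (auto simp: doubleton_eq_iff)
  qed
  then have "card S \<le> card (uedges T)"
    using nb fin subE by (intro card_inj_on_le) (auto intro: finite_subset)
  also have "\<dots> = card (c ` uedges T)" using inj by (simp add: card_image)
  also have "\<dots> \<le> card (c ` uedges G)" using fin subE by (intro card_mono) auto
  finally show ?thesis .
qed

section \<open>The colouring by comparison of indices\<close>

definition comparison_coloring ::
  "'a set \<Rightarrow> 'a set \<Rightarrow> ('a \<Rightarrow> nat) \<Rightarrow> nat \<Rightarrow> nat \<Rightarrow> nat \<Rightarrow> ('a set \<Rightarrow> nat) \<Rightarrow> bool" where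
  "comparison_coloring U V h e l g c \<longleftrightarrow>
     (\<forall>u\<in>U. \<forall>v\<in>V. c {u, v} = (if h u = h v then e else if h u < h v then l else g))"

text \<open>The symmetry between the two sides of the bipartition.\<close>

lemma comparison_coloring_swap:
  "comparison_coloring U V h e l g c \<Longrightarrow> comparison_coloring V U h e g l c"
  unfolding comparison_coloring_def
  by (metis insert_commute less_imp_neq linorder_neqE_nat order_less_asym)

lemma comparison_coloring_exists:
  assumes "U \<inter> V = {}"
  obtains c where "comparison_coloring U V h e l g c"
proof
  let ?F = "\<lambda>u v. if h u = h v then e else if h u < h v then l else g"
  have "{u, v} \<inter> U = {u}" "{u, v} \<inter> V = {v}" if "u \<in> U" "v \<in> V" for u v
    using assms that by auto
  then have "?F (the_elem ({u, v} \<inter> U)) (the_elem ({u, v} \<inter> V)) = ?F u v"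
    if "u \<in> U" "v \<in> V" for u v
    using that by (simp only: the_elem_eq)
  then show "comparison_coloring U V h e l g (\<lambda>s. ?F (the_elem (s \<inter> U)) (the_elem (s \<inter> V)))"
    unfolding comparison_coloring_def by blast
qed

lemma common_index_exists:
  fixes U V :: "'a set"
  assumes "finite U" "finite V" "card U = card V" "U \<inter> V = {}"
  obtains h :: "'a \<Rightarrow> nat" where "inj_on h U" "inj_on h V" "h ` U = h ` V"
proof -
  obtain f where f: "bij_betw f U {..<card U}"
    using ex_bij_betw_finite_nat[OF assms(1)] by (auto simp: lessThan_atLeast0)
  obtain g where g: "bij_betw g V {..<card U}"
    using ex_bij_betw_finite_nat[OF assms(2)] assms(3) by (auto simp: lessThan_atLeast0)
  let ?h = "\<lambda>x. if x \<in> U then f x else g x"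
  have "bij_betw ?h U {..<card U}" using f by (simp cong: bij_betw_cong)
  moreover have "bij_betw ?h V {..<card U}"
    using g assms(4) by (subst bij_betw_cong[of V ?h g]) auto
  ultimately show thesis by (intro that[of ?h]) (auto simp: bij_betw_def)
qed

lemma card_2_sorted:
  fixes h :: "'a \<Rightarrow> nat"
  assumes "card S = 2" "inj_on h S"
  obtains x y where "S = {x, y}" "h x < h y"
proof -
  obtain x y where "S = {x, y}" "x \<noteq> y" using assms(1) by (auto simp: card_2_iff)
  moreover then have "h x \<noteq> h y" using assms(2) by (auto simp: inj_on_def)
  ultimately show thesis using that by (metis insert_commute linorder_neqE_nat)
qed

lemma card_3_sorted:
  fixes h :: "'a \<Rightarrow> nat"
  assumes "card S = 3" "inj_on h S"
  obtains x y z where "S = {x, y, z}" "h x < h y" "h y < h z"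
proof -
  have fin: "finite S" "S \<noteq> {}" using assms(1) card.infinite by fastforce+
  obtain x where x: "x \<in> S" "\<And>w. w \<in> S \<Longrightarrow> h x \<le> h w"
    using ex_min_if_finite[of "h ` S"] fin by (auto simp: not_less)
  have "card (S - {x}) = 2" using assms(1) x fin by simp
  then obtain y z where yz: "S - {x} = {y, z}" "h y < h z"
    using card_2_sorted inj_on_diff[OF assms(2)] by metis
  have "y \<in> S" "y \<noteq> x" using yz by auto
  then have "h x < h y" using x assms(2) by (metis inj_onD le_neq_implies_less)
  moreover have "S = {x, y, z}" using yz x by auto
  ultimately show thesis using that yz by blast
qed

text \<open>
  Only the triples with at least two vertices in \<open>U\<close> are treated here; exchanging the two
  sides accounts for the others.
\<close>

lemma rainbow_S_tree_two_on_side: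
  assumes G: "pair_graph G" and verts: "U \<union> V \<subseteq> pverts G"
    and arcs: "U \<times> V \<union> V \<times> U \<subseteq> parcs G" and disj: "U \<inter> V = {}"
    and col: "comparison_coloring U V h e l g c" and elg: "distinct [e, l, g]"
    and h: "inj_on h U" "inj_on h V" "h ` U = h ` V"
    and S: "S \<subseteq> U \<union> V" "card S = 3" "2 \<le> card (S \<inter> U)"
  shows "\<exists>T. rainbow_S_tree G c S T"
proof -
  have "\<exists>W F. rainbow_tree_on G c W F \<and> S \<subseteq> W"
  proof -
    have c: "c {u, v} = (if h u = h v then e else if h u < h v then l else g)"
      "c {v, u} = (if h u = h v then e else if h u < h v then l else g)"
      if "u \<in> U" "v \<in> V" for u v
      using col that by (auto simp: comparison_coloring_def insert_commute)
    have partner: "\<exists>v\<in>V. h v = h u" if "u \<in> U" for u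
      using h(3) that by (metis imageE image_eqI)
    have single: "rainbow_tree_on G c {v} {}" if "v \<in> U \<union> V" for v
      using rainbow_tree_on_single[OF G] verts that by blast
    note leaf = rainbow_tree_on_insert_leaf
    have fin: "finite S" using S(2) card.infinite by fastforce
    have "card (S \<inter> U) \<le> 3" using card_mono[OF fin, of "S \<inter> U"] S(2) by simp
    then consider "card (S \<inter> U) = 3" | "card (S \<inter> U) = 2" using S(3) by linarith
    then show ?thesis
    proof cases
      case 1
      then have SU: "S \<subseteq> U" using card_subset_eq[OF fin, of "S \<inter> U"] S(2) by auto
      obtain x y z where xyz: "S = {x, y, z}" "h x < h y" "h y < h z"
        using card_3_sorted[OF S(2) inj_on_subset[OF h(1) SU]] by metis
      then have U: "x \<in> U" "y \<in> U" "z \<in> U" using SU by auto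
      obtain w where w: "w \<in> V" "h w = h y" using partner U by blast
      have ne: "w \<notin> {x, y, z}" "x \<noteq> y" "y \<noteq> z" "x \<noteq> z" using U w disj xyz by auto
      have col: "c {w, x} = l" "c {w, y} = e" "c {w, z} = g" using U w xyz by (auto simp: c)
      have t1: "rainbow_tree_on G c {x, w} {{w, x}}"
        using leaf[OF single[of w], of w x] U w ne arcs by auto
      have t2: "rainbow_tree_on G c {y, x, w} {{w, y}, {w, x}}"
        using leaf[OF t1, of w y] U w ne arcs elg by (auto simp: col)
      have t3: "rainbow_tree_on G c {z, y, x, w} {{w, z}, {w, y}, {w, x}}"
        using leaf[OF t2, of w z] U w ne arcs elg by (auto simp: col)
      show ?thesis using t3 xyz by blast
    next
      case 2
      obtain x y where xy: "S \<inter> U = {x, y}" "h x < h y"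
        using card_2_sorted[OF 2 inj_on_subset[OF h(1)]] by (metis inf_le2)
      then have U: "x \<in> U" "y \<in> U" by auto
      have "card (S - U) = 1" using card_Diff_subset_Int[of S U] fin S(2) 2 by simp
      then obtain w where w: "S - U = {w}" by (auto simp: card_1_singleton_iff)
      then have V: "w \<in> V" and Sxyw: "S = {x, y, w}" using S(1) xy by auto
      have ne: "w \<noteq> x" "w \<noteq> y" "x \<noteq> y" using U V disj xy by auto
      consider "h x \<le> h w" "h w \<le> h y" | "h y < h w" | "h w < h x" by linarith
      then show ?thesis
      proof cases
        case 1
        have t1: "rainbow_tree_on G c {x, w} {{w, x}}"
          using leaf[OF single[of w], of w x] U V ne arcs by auto
        have "c {w, y} \<noteq> c {w, x}" using U V 1 xy elg by (auto simp: c)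
        then have t2: "rainbow_tree_on G c {y, x, w} {{w, y}, {w, x}}"
          using leaf[OF t1, of w y] U V ne arcs by auto
        show ?thesis using t2 Sxyw by blast
      next
        \<comment> \<open>The path \<open>w, y, v, x\<close> has colours \<open>l\<close>, \<open>g\<close>, \<open>e\<close>.\<close>
        case 2
        obtain v where v: "v \<in> V" "h v = h x" using partner U by blast
        have ne': "v \<notin> {w, x, y}" using U v disj xy 2 by auto
        have col: "c {w, y} = l" "c {y, v} = g" "c {v, x} = e"
          using U V v xy 2 by (auto simp: c)
        have t1: "rainbow_tree_on G c {y, w} {{w, y}}"
          using leaf[OF single[of w], of w y] U V ne arcs by auto
        have t2: "rainbow_tree_on G c {v, y, w} {{y, v}, {w, y}}"
          using leaf[OF t1, of y v] U V v ne ne' arcs elg by (auto simp: col)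
        have t3: "rainbow_tree_on G c {x, v, y, w} {{v, x}, {y, v}, {w, y}}"
          using leaf[OF t2, of v x] U V v ne ne' arcs elg by (auto simp: col)
        show ?thesis using t3 Sxyw by blast
      next
        \<comment> \<open>The path \<open>w, x, v, y\<close> has colours \<open>g\<close>, \<open>l\<close>, \<open>e\<close>.\<close>
        case 3
        obtain v where v: "v \<in> V" "h v = h y" using partner U by blast
        have ne': "v \<notin> {w, x, y}" using U v disj xy 3 by auto
        have col: "c {w, x} = g" "c {x, v} = l" "c {v, y} = e"
          using U V v xy 3 by (auto simp: c)
        have t1: "rainbow_tree_on G c {x, w} {{w, x}}"
          using leaf[OF single[of w], of w x] U V ne arcs by auto
        have t2: "rainbow_tree_on G c {v, x, w} {{x, v}, {w, x}}"
          using leaf[OF t1, of x v] U V v ne ne' arcs elg by (auto simp: col)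
        have t3: "rainbow_tree_on G c {y, v, x, w} {{v, y}, {x, v}, {w, x}}"
          using leaf[OF t2, of v y] U V v ne ne' arcs elg by (auto simp: col)
        show ?thesis using t3 Sxyw by blast
      qed
    qed
  qed
  then show ?thesis by (auto simp: rainbow_tree_on_def rainbow_S_tree_def)
qed

theorem theorem5:
  fixes r :: nat and G :: "'a pair_pre_digraph"
  assumes "3 \<le> r"
    and "K\<^bsub>r,r\<^esub> (with_proj G)"
  shows "rx3 G = 3"
proof -
  have G: "pair_graph G" using pair_graphI_complete_bipartite[OF assms(2)] .
  obtain U V where verts: "pverts G = U \<union> V" and disj: "U \<inter> V = {}"
    and card: "card U = r" "card V = r" and arcs: "parcs G = U \<times> V \<union> V \<times> U"
    and "finite (pverts G)"
    using assms(2) unfolding complete_bipartite_digraph_pair_def by blast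
  then have fin: "finite U" "finite V" by auto
  obtain A where A: "A \<subseteq> U" "card A = 3"
    using obtain_subset_with_card_n[of 3 U] assms(1) card by metis
  have lower: "3 \<le> card (c ` uedges G)" if rc: "rainbow_coloring_3 G c" for c
  proof -
    obtain T where "rainbow_S_tree G c A T"
      using rc A verts unfolding rainbow_coloring_3_def by blast
    then show ?thesis
      using card_independent_le_card_colors[OF G, of c A T] A disj arcs by fastforce
  qed
  obtain h :: "'a \<Rightarrow> nat" where h: "inj_on h U" "inj_on h V" "h ` U = h ` V"
    using common_index_exists[OF fin _ disj] card by metis
  obtain c where c: "comparison_coloring U V h 0 1 2 c"
    using comparison_coloring_exists[OF disj] by metis
  have rainbow: "rainbow_coloring_3 G c"
    unfolding rainbow_coloring_3_def
  proof (intro allI impI, elim conjE)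
    fix S assume S: "S \<subseteq> pverts G" "card S = 3"
    then have "finite S" using card.infinite by fastforce
    have "S = (S \<inter> U) \<union> (S \<inter> V)" using S(1) verts by auto
    then have "card S \<le> card (S \<inter> U) + card (S \<inter> V)" by (metis card_Un_le)
    then consider "2 \<le> card (S \<inter> U)" | "2 \<le> card (S \<inter> V)" using S(2) by linarith
    then show "\<exists>T. rainbow_S_tree G c S T"
    proof cases
      case 1
      show ?thesis
        by (rule rainbow_S_tree_two_on_side[OF G _ _ disj c _ h])
           (use S 1 verts arcs in auto)
    next
      case 2
      show ?thesis
        by (rule rainbow_S_tree_two_on_side[OF G _ _ _ comparison_coloring_swap[OF c]
              _ h(2,1) h(3)[symmetric]])
           (use S 2 verts arcs disj in auto)
    qed
  qed
  have "c ` uedges G \<subseteq> {0, 1, 2}"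
  proof
    have range: "c {u, v} \<in> {0, 1, 2}" if "u \<in> U" "v \<in> V" for u v
      using c that by (simp add: comparison_coloring_def)
    fix k assume "k \<in> c ` uedges G"
    then obtain u v where k: "k = c {u, v}" "(u, v) \<in> parcs G"
      by (auto simp: uedges_def)
    then have "k = c {v, u}" by (simp add: insert_commute)
    moreover have "u \<in> U \<and> v \<in> V \<or> v \<in> U \<and> u \<in> V" using k(2) arcs by auto
    ultimately show "k \<in> {0, 1, 2}" using k(1) range by metis
  qed
  then have "card (c ` uedges G) \<le> card {0, 1, 2 :: nat}" by (intro card_mono) auto
  then have "card (c ` uedges G) = 3" using lower[OF rainbow] by simp
  then show ?thesis
    unfolding rx3_def using rainbow lower by (intro Least_equality) auto
qed

end
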